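(* For every integer $N\ge 3$ there exists a linear subspace $E$ of $F=\ell^3_N$ with $\dim E=N-2$ such that no $2$-dimensional linear subspace of $F$ is orthogonal to $E$.
   Context: $\ell^3_N$ is $\mathbb R^N$ with the norm $\|x\|=\left(\sum_{i=1}^N|x_i|^3\right)^{1/3}$. For linear subspaces $X_1,X_2$ of a normed space, $X_1$ is called orthogonal to $X_2$ if $\operatorname{dist}(x,X_2)=1$ for every $x\in X_1$ with $\|x\|=1$. (The relation is not symmetric in $X_1,X_2$.) *)

theory Defs
  imports "HOL-Analysis.Analysis"
begin

text \<open>
  The library norm on \<open>real ^ 'n\<close> is the Euclidean one, so the \<open>\<ell>\<^sup>3\<close> norm is a separate
  function, and distance and orthogonality take the norm as a parameter.
\<close>

definition l3_norm :: "real ^ 'n \<Rightarrow> real" where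
  "l3_norm x = root 3 (\<Sum>i\<in>UNIV. \<bar>x $ i\<bar> ^ 3)"

definition dist_to_set :: "('a::real_vector \<Rightarrow> real) \<Rightarrow> 'a \<Rightarrow> 'a set \<Rightarrow> real" where
  "dist_to_set nrm x S = (INF y\<in>S. nrm (x - y))"

definition orthogonal_subspace :: "('a::real_vector \<Rightarrow> real) \<Rightarrow> 'a set \<Rightarrow> 'a set \<Rightarrow> bool" where
  "orthogonal_subspace nrm X1 X2 \<longleftrightarrow> (\<forall>x\<in>X1. nrm x = 1 \<longrightarrow> dist_to_set nrm x X2 = 1)"

end

theory Submission imports Defs begin

text \<open>
  Take \<open>E = {y. y\<^sub>a = y\<^sub>b = y\<^sub>c}\<close> for three distinct indices. The cubed norm is differentiable, so if
  \<open>X\<close> is orthogonal to \<open>E\<close>, every \<open>x\<close> in \<open>X\<close> satisfies \<open>\<Sum>i. x\<^sub>i \<bar>x\<^sub>i\<bar> y\<^sub>i = 0\<close> for all \<open>y\<close> in \<open>E\<close>.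
  Hence \<open>x\<close> is supported on \<open>{a, b, c}\<close> and \<open>x\<^sub>a \<bar>x\<^sub>a\<bar> + x\<^sub>b \<bar>x\<^sub>b\<bar> + x\<^sub>c \<bar>x\<^sub>c\<bar> = 0\<close>. A plane \<open>X\<close> contains
  nonzero vectors vanishing at \<open>a\<close> and at \<open>c\<close>, which up to scaling are \<open>(0, 1, -1)\<close> and
  \<open>(1, -1, 0)\<close>; then it also contains \<open>(1, 1, -2)\<close>, which violates the equation.
\<close>

lemma l3_norm_nonneg: "0 \<le> l3_norm x"
  by (simp add: l3_norm_def sum_nonneg)

lemma l3_norm_scaleR: "l3_norm (c *\<^sub>R x) = \<bar>c\<bar> * l3_norm x"
  by (simp add: l3_norm_def abs_mult power_mult_distrib real_root_mult real_root_power_cancel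
      flip: sum_distrib_left)

lemma l3_norm_le_iff: "l3_norm x \<le> l3_norm y \<longleftrightarrow> (\<Sum>i\<in>UNIV. \<bar>x $ i\<bar> ^ 3) \<le> (\<Sum>i\<in>UNIV. \<bar>y $ i\<bar> ^ 3)"
  by (simp add: l3_norm_def)

text \<open>Both sides scale alike, so a vector of nonzero norm may be normalised. On the unit
  sphere the infimum over \<open>E\<close> is 1, hence a lower bound for the norm at each single
  point of \<open>E\<close>.\<close>

lemma orthogonal_subspace_l3_norm_le:
  assumes "orthogonal_subspace l3_norm X E" "subspace X" "subspace E" "x \<in> X" "y \<in> E"
  shows "l3_norm x \<le> l3_norm (x - y)"
proof (cases "l3_norm x = 0")
  case True
  then show ?thesis by (simp add: l3_norm_nonneg)
next
  case False
  define r where "r = l3_norm x"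
  have r: "r > 0"
    using False l3_norm_nonneg[of x] by (simp add: r_def)
  have "l3_norm (inverse r *\<^sub>R x) = 1"
    using r by (simp add: l3_norm_scaleR r_def)
  then have "1 = (INF z\<in>E. l3_norm (inverse r *\<^sub>R x - z))"
    using assms by (simp add: orthogonal_subspace_def dist_to_set_def subspace_scale)
  also have "\<dots> \<le> l3_norm (inverse r *\<^sub>R x - inverse r *\<^sub>R y)"
    using assms by (intro cINF_lower) (auto intro!: bdd_belowI2[of _ 0] l3_norm_nonneg subspace_scale)
  also have "\<dots> = l3_norm (x - y) / r"
    using r by (simp add: l3_norm_scaleR divide_inverse mult.commute flip: scaleR_diff_right)
  finally show ?thesis
    using r by (simp add: r_def[symmetric])
qed

text \<open>At 0 the difference quotient is \<open>t * \<bar>t\<bar>\<close>, which tends to 0.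
  Elsewhere the sign is locally constant, so the function agrees nearby with the polynomial
  \<open>(sgn x * t) ^ 3\<close>.\<close>

lemma DERIV_abs_cubed:
  fixes x :: real
  shows "((\<lambda>t. \<bar>t\<bar> ^ 3) has_real_derivative 3 * (x * \<bar>x\<bar>)) (at x)"
proof (cases "x = 0")
  case True
  have "((\<lambda>t::real. \<bar>t\<bar> ^ 3 / t) \<longlongrightarrow> 0) (at 0)"
  proof (rule Lim_transform_eventually)
    show "((\<lambda>t::real. t * \<bar>t\<bar>) \<longlongrightarrow> 0) (at 0)"
      by (auto intro!: tendsto_eq_intros)
    show "\<forall>\<^sub>F t::real in at 0. t * \<bar>t\<bar> = \<bar>t\<bar> ^ 3 / t"
      by (auto simp: eventually_at_filter power3_eq_cube abs_if)
  qed
  then show ?thesis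
    using True by (simp add: has_field_derivative_iff)
next
  case False
  have "((\<lambda>t. (sgn x * t) ^ 3) has_real_derivative 3 * (x * \<bar>x\<bar>)) (at x)"
    using False by (auto intro!: derivative_eq_intros simp: sgn_if power2_eq_square)
  then show ?thesis
    by (rule has_field_derivative_transform_within_open[where S = "{t. 0 < sgn x * t}"])
       (use False in \<open>auto simp: sgn_if split: if_splits intro!: open_Collect_less continuous_intros\<close>)
qed

text \<open>Along the line \<open>x - t * y\<close> the cubed norm is minimal at
  \<open>t = 0\<close>, so its derivative there, which is -3 times this sum, vanishes.\<close>

lemma orthogonal_subspace_l3_norm_imp_sum_eq_0:
  assumes "orthogonal_subspace l3_norm X E" "subspace X" "subspace E" "x \<in> X" "y \<in> E"
  shows "(\<Sum>i\<in>UNIV. x $ i * \<bar>x $ i\<bar> * y $ i) = 0"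
proof -
  have *: "((\<lambda>t. \<bar>x $ i - t * y $ i\<bar> ^ 3) has_real_derivative - 3 * (x $ i * \<bar>x $ i\<bar> * y $ i)) (at 0)" for i
  proof -
    have "((\<lambda>t. x $ i - t * y $ i) has_real_derivative - y $ i) (at 0)"
      by (auto intro!: derivative_eq_intros)
    from DERIV_chain2[OF DERIV_abs_cubed this] show ?thesis
      by (simp add: mult.assoc)
  qed
  have "((\<lambda>t. \<Sum>i\<in>UNIV. \<bar>x $ i - t * y $ i\<bar> ^ 3) has_real_derivative
          (\<Sum>i\<in>UNIV. - 3 * (x $ i * \<bar>x $ i\<bar> * y $ i))) (at 0)"
    by (intro DERIV_sum *)
  moreover have "(\<Sum>i\<in>UNIV. \<bar>x $ i - 0 * y $ i\<bar> ^ 3) \<le> (\<Sum>i\<in>UNIV. \<bar>x $ i - t * y $ i\<bar> ^ 3)" for t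
    using orthogonal_subspace_l3_norm_le[OF assms(1-4), of "t *\<^sub>R y"] assms(3,5)
    by (simp add: l3_norm_le_iff subspace_scale)
  ultimately have "(\<Sum>i\<in>UNIV. - 3 * (x $ i * \<bar>x $ i\<bar> * y $ i)) = 0"
    by (intro DERIV_local_min[where d = 1]) auto
  then show ?thesis
    by (simp add: sum_negf flip: sum_distrib_left)
qed

text \<open>A coordinate functional has image of dimension at most 1, so it cannot be injective on
  \<open>X\<close>.\<close>

lemma exists_nonzero_nth_eq_0:
  fixes X :: "(real ^ 'n) set"
  assumes "subspace X" "dim X \<ge> 2"
  obtains v where "v \<in> X" "v \<noteq> 0" "v $ k = 0"
proof -
  have "\<not> inj_on (\<lambda>v. v $ k) X"
  proof
    assume "inj_on (\<lambda>v. v $ k) X"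
    then have "dim ((\<lambda>v. v $ k) ` X) = dim X"
      using assms by (intro dim_image_eq bounded_linear.linear[OF bounded_linear_vec_nth]) (simp_all add: span_eq_iff[THEN iffD2])
    then show False
      using assms dim_subset_UNIV[of "(\<lambda>v. v $ k) ` X"] by simp
  qed
  then obtain u w where "u \<in> X" "w \<in> X" "u \<noteq> w" "u $ k = w $ k"
    by (auto simp: inj_on_def)
  then show ?thesis
    using assms that[of "u - w"] by (simp add: subspace_diff)
qed

text \<open>The set is the Euclidean orthogonal complement of the plane spanned by
  \<open>axis a 1 - axis b 1\<close> and \<open>axis b 1 - axis c 1\<close>.\<close>

lemma dim_three_equal_coordinates:
  fixes a b c :: "'n::finite"
  assumes "a \<noteq> b" "b \<noteq> c" "a \<noteq> c"
  shows "dim {y :: real ^ 'n. y $ a = y $ b \<and> y $ b = y $ c} = CARD('n) - 2"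
proof -
  let ?u = "axis a 1 - axis b 1 :: real ^ 'n" and ?v = "axis b 1 - axis c 1 :: real ^ 'n"
  have ne: "?u \<noteq> ?v"
    using assms by (auto simp: vec_eq_iff axis_def dest!: spec[of _ a])
  have "independent {?u, ?v}"
  proof -
    have "?u \<notin> span {?v}"
    proof
      assume "?u \<in> span {?v}"
      then obtain k where "?u = k *\<^sub>R ?v"
        by (auto simp: span_singleton)
      then have "?u $ a = (k *\<^sub>R ?v) $ a" by simp
      then show False
        using assms by (simp add: axis_def)
    qed
    moreover have "?v \<noteq> 0"
      using assms by (auto simp: vec_eq_iff axis_def dest!: spec[of _ b])
    ultimately show ?thesis
      using ne by (simp add: independent_insert)
  qed
  then have "dim {?u, ?v} = 2"
    using ne by (simp add: dim_eq_card_independent)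
  moreover have "{y :: real ^ 'n. y $ a = y $ b \<and> y $ b = y $ c} =
      {y \<in> UNIV. \<forall>x\<in>span {?u, ?v}. orthogonal x y}" (is "?L = ?R")
  proof
    show "?L \<subseteq> ?R"
    proof
      fix y :: "real ^ 'n"
      assume "y \<in> ?L"
      then have "orthogonal y x" if "x \<in> span {?u, ?v}" for x
        by (intro orthogonal_to_span[OF that]) (auto simp: orthogonal_def inner_diff_right inner_axis)
      then show "y \<in> ?R" by (simp add: orthogonal_commute)
    qed
    show "?R \<subseteq> ?L"
    proof
      fix y :: "real ^ 'n"
      assume "y \<in> ?R"
      then have "orthogonal ?u y" "orthogonal ?v y"
        by (auto intro: span_base)
      then show "y \<in> ?L"
        by (simp add: orthogonal_def inner_diff_left inner_axis')
    qed
  qed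
  ultimately show ?thesis
    using dim_subspace_orthogonal_to_vectors[of "span {?u, ?v}" UNIV] by simp
qed

text \<open>The map \<open>s * \<bar>s\<bar>\<close> is odd and injective.\<close>

lemma mult_abs_add_eq_0_iff:
  fixes s t :: real
  shows "s * \<bar>s\<bar> + t * \<bar>t\<bar> = 0 \<longleftrightarrow> t = - s"
proof
  assume eq: "s * \<bar>s\<bar> + t * \<bar>t\<bar> = 0"
  then have "\<bar>s * \<bar>s\<bar>\<bar> = \<bar>t * \<bar>t\<bar>\<bar>" by linarith
  then have "\<bar>s\<bar> = \<bar>t\<bar>"
    by (simp add: abs_mult abs_eq_iff power2_eq_iff flip: power2_eq_square)
  with eq show "t = - s"
    by (auto simp: abs_if split: if_splits)
qed simp

theorem mainTheorem2:
  assumes "CARD('n::finite) \<ge> 3"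
  shows "\<exists>E :: (real ^ 'n) set. subspace E \<and> dim E = CARD('n) - 2 \<and>
           \<not> (\<exists>X :: (real ^ 'n) set. subspace X \<and> dim X = 2 \<and> orthogonal_subspace l3_norm X E)"
proof -
  obtain T :: "'n set" where "card T = 3"
    using obtain_subset_with_card_n[OF assms] by blast
  then obtain a b c :: 'n where abc: "a \<noteq> b" "b \<noteq> c" "a \<noteq> c"
    by (auto simp: card_3_iff)
  define E where "E = {y :: real ^ 'n. y $ a = y $ b \<and> y $ b = y $ c}"
  have E: "subspace E"
    by (auto simp: E_def subspace_def)
  have False if X: "subspace X" "dim X = 2" "orthogonal_subspace l3_norm X E" for X
  proof -
    note sum0 = orthogonal_subspace_l3_norm_imp_sum_eq_0[OF X(3,1) E]
    have supp: "x $ j = 0" if "x \<in> X" "j \<notin> {a, b, c}" for x j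
    proof -
      \<comment> \<open>All three distinguished coordinates of this vector are 0; testing against it
        isolates the term of index \<open>j\<close>.\<close>
      have "axis j 1 \<in> E"
        using that by (auto simp: E_def axis_def)
      from sum0[OF that(1) this] show ?thesis
        by (simp add: axis_def if_distrib cong: if_cong)
    qed
    have eq: "x $ a * \<bar>x $ a\<bar> + x $ b * \<bar>x $ b\<bar> + x $ c * \<bar>x $ c\<bar> = 0" if "x \<in> X" for x
    proof -
      have "(\<chi> i. 1) \<in> E" by (simp add: E_def)
      from sum0[OF that this] have "0 = (\<Sum>i\<in>UNIV. x $ i * \<bar>x $ i\<bar>)" by simp
      also have "\<dots> = (\<Sum>i\<in>{a, b, c}. x $ i * \<bar>x $ i\<bar>)"
        using supp[OF that] by (intro sum.mono_neutral_right) auto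
      finally show ?thesis using abc by simp
    qed
    obtain v where v: "v \<in> X" "v \<noteq> 0" "v $ a = 0"
      using exists_nonzero_nth_eq_0[of X] X by (metis order_refl)
    obtain w where w: "w \<in> X" "w \<noteq> 0" "w $ c = 0"
      using exists_nonzero_nth_eq_0[of X] X by (metis order_refl)
    have vc: "v $ c = - v $ b"
      using eq[OF v(1)] v(3) by (simp add: mult_abs_add_eq_0_iff)
    have wb: "w $ b = - w $ a"
      using eq[OF w(1)] w(3) by (simp add: mult_abs_add_eq_0_iff)
    \<comment> \<open>Otherwise \<open>v\<close> would vanish at \<open>a\<close>, \<open>b\<close>
      and \<open>c\<close>, and by \<open>supp\<close> everywhere.\<close>
    have "v $ b \<noteq> 0"
      using v vc supp[OF v(1)] by (metis insertE minus_zero singletonD vec_eq_iff zero_index)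
    have "w $ a \<noteq> 0"
      using w wb supp[OF w(1)] by (metis insertE minus_zero singletonD vec_eq_iff zero_index)
    \<comment> \<open>On \<open>a, b, c\<close> the summands are (0, 2, -2) and (1, -1, 0). The
      factor 2 matters: with 1 the sum would be (1, 0, -1), which satisfies \<open>eq\<close>,
      whereas (1, 1, -2) gives 1 + 1 - 4.\<close>
    define x where "x = (2 / v $ b) *\<^sub>R v + (1 / w $ a) *\<^sub>R w"
    have "x \<in> X"
      using v w X by (simp add: x_def subspace_add subspace_scale)
    moreover have "x $ a = 1" "x $ b = 1" "x $ c = -2"
      using v w vc wb \<open>v $ b \<noteq> 0\<close> \<open>w $ a \<noteq> 0\<close> by (simp_all add: x_def)
    ultimately show False
      using eq[of x] by simp
  qed
  then show ?thesis
    using E dim_three_equal_coordinates[OF abc] unfolding E_def by blast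
qed

end
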